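(* Let $h(\eta)=q_1q_2^{-\eta}$ with constants $q_1>0$ and $q_2>1$. Then $$h^{-1}(b)=\frac{\log q_1-\log b}{\log q_2},\qquad \nabla_bh^{-1}(b)=-\frac{1}{b\log q_2}.$$ Moreover, let $K\ge1$, $L,R,A_K>0$ and $u_0,\dots,u_{K-1}>0$ be fixed. The optimal primal solution and the optimal dual multiplier $\lambda^*$ of the inequality constraint of $$\min_{\mathbf{b}\ge\mathbf{0}}\ \sum_{k=0}^{K-1}h^{-1}(b_k)\quad\text{s.t.}\quad\sum_{k=0}^{K-1}u_kb_k^2\le\frac{LR^2}{4A_K}$$ are $$b_k^*=\sqrt{\frac{LR^2}{4KA_Ku_k}},\quad k=0,\dots,K-1,\qquad \lambda^*=\frac{2KA_K}{LR^2\log q_2}.$$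
   Context: The Lagrangian of the problem is $\mathcal{L}(\mathbf{b},\lambda)=\sum_{k=0}^{K-1}h^{-1}(b_k)+\lambda\left(\sum_{k=0}^{K-1}u_kb_k^2-\frac{LR^2}{4A_K}\right)$. The weights $u_k$ are treated as fixed positive numbers independent of $\mathbf{b}$; $\log$ is the natural logarithm, and $h^{-1}(b)$ is given by the displayed formula for all $b>0$ (the objective is regarded as $+\infty$ if some $b_k=0$). *)

theory Defs
  imports Complex_Main "HOL-Library.Extended_Real"
begin

definition h :: "real \<Rightarrow> real \<Rightarrow> real \<Rightarrow> real" where
  "h q1 q2 \<eta> = q1 * q2 powr (- \<eta>)"

text \<open>
  The inverse of \<open>h q1 q2\<close> is rendered by the library's \<open>inv\<close>. The following fact shows that this is
  a genuine inverse on the positive reals; outside of them the value of \<open>inv (h q1 q2)\<close> is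
  meaningless and never used below.
\<close>

lemma bij_betw_h:
  assumes "q1 > 0" and "q2 > 1"
  shows "bij_betw (h q1 q2) UNIV {0<..}"
  unfolding bij_betw_def
proof
  show "inj (h q1 q2)"
    using assms by (auto simp: inj_def h_def powr_inj)
  show "range (h q1 q2) = {0<..}"
  proof
    show "range (h q1 q2) \<subseteq> {0<..}"
      using assms by (auto simp: h_def)
    show "{0<..} \<subseteq> range (h q1 q2)"
    proof
      fix b :: real assume "b \<in> {0<..}"
      then have "h q1 q2 (- log q2 (b / q1)) = b"
        using assms by (simp add: h_def)
      then show "b \<in> range (h q1 q2)"
        by (metis rangeI)
    qed
  qed
qed

text \<open>
  Vectors with \<open>K\<close> entries are functions \<open>b :: nat \<Rightarrow> real\<close> of which only the values at
  indices below \<open>K\<close> are ever inspected. The objective is \<open>\<infinity>\<close> as soon as one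
  coordinate vanishes; hence it takes values in the extended reals.
\<close>

definition objective :: "real \<Rightarrow> real \<Rightarrow> nat \<Rightarrow> (nat \<Rightarrow> real) \<Rightarrow> ereal" where
  "objective q1 q2 K b = (\<Sum>k<K. if b k > 0 then ereal (inv (h q1 q2) (b k)) else \<infinity>)"

definition nonneg :: "nat \<Rightarrow> (nat \<Rightarrow> real) \<Rightarrow> bool" where
  "nonneg K b \<longleftrightarrow> (\<forall>k<K. b k \<ge> 0)"

definition feasible ::
    "nat \<Rightarrow> (nat \<Rightarrow> real) \<Rightarrow> real \<Rightarrow> real \<Rightarrow> real \<Rightarrow> (nat \<Rightarrow> real) \<Rightarrow> bool" where
  "feasible K u L R A b \<longleftrightarrow>
     nonneg K b \<and> (\<Sum>k<K. u k * (b k)\<^sup>2) \<le> L * R\<^sup>2 / (4 * A)"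

definition lagrangian ::
    "real \<Rightarrow> real \<Rightarrow> nat \<Rightarrow> (nat \<Rightarrow> real) \<Rightarrow> real \<Rightarrow> real \<Rightarrow> real \<Rightarrow> (nat \<Rightarrow> real) \<Rightarrow> real \<Rightarrow> ereal" where
  "lagrangian q1 q2 K u L R A b l =
     objective q1 q2 K b + ereal (l * ((\<Sum>k<K. u k * (b k)\<^sup>2) - L * R\<^sup>2 / (4 * A)))"

text \<open>
  Only the quadratic constraint is dualized; the sign constraint on \<open>b\<close> stays in the domain of
  the infimum. An optimal dual multiplier is a maximizer of this function over \<open>l \<ge> 0\<close>.
\<close>

definition dual_function ::
    "real \<Rightarrow> real \<Rightarrow> nat \<Rightarrow> (nat \<Rightarrow> real) \<Rightarrow> real \<Rightarrow> real \<Rightarrow> real \<Rightarrow> real \<Rightarrow> ereal" where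
  "dual_function q1 q2 K u L R A l = (INF b\<in>Collect (nonneg K). lagrangian q1 q2 K u L R A b l)"

end

theory Submission
  imports Defs
begin

text \<open>
  Everything follows from \<open>ln x \<le> x - 1\<close>, applied to \<open>x = u k * (b k)\<^sup>2 / t\<close> and summed over
  \<open>k\<close>. It shows that \<open>w k = sqrt (t / u k)\<close> is the unique minimizer of the Lagrangian for the
  multiplier \<open>1 / (2 * t * ln q2)\<close>. Taking for \<open>t\<close> the budget divided by \<open>K\<close> makes \<open>w\<close> tight for
  the constraint, which settles the primal problem and gives the dual value at the optimal multiplier. For
  any other positive multiplier, its own Lagrangian minimizer beats the primal optimum, so the dual
  value is strictly smaller; for the multiplier \<open>0\<close> doubling \<open>t\<close> does the same.
\<close>

section \<open>The inverse of \<open>h\<close> and its derivative\<close>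

lemma inv_h:
  assumes "q1 > 0" and "q2 > 1" and "b > 0"
  shows "inv (h q1 q2) b = (ln q1 - ln b) / ln q2"
proof (rule inv_f_eq)
  show "inj (h q1 q2)"
    using bij_betw_h[OF assms(1,2)] by (simp add: bij_betw_def)
  show "h q1 q2 ((ln q1 - ln b) / ln q2) = b"
    using assms by (simp add: h_def powr_def exp_diff)
qed

lemma has_real_derivative_inv_h:
  assumes "q1 > 0" and "q2 > 1" and "b > 0"
  shows "(inv (h q1 q2) has_real_derivative - (1 / (b * ln q2))) (at b)"
proof -
  have "((\<lambda>b. (ln q1 - ln b) / ln q2) has_real_derivative - (1 / (b * ln q2))) (at b)"
    using assms by (auto intro!: derivative_eq_intros simp: field_simps)
  then show ?thesis
    by (rule has_field_derivative_transform_within_open[where S = "{0<..}"])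
       (use assms in \<open>auto simp: inv_h\<close>)
qed

section \<open>The objective on positive vectors and off them\<close>

lemma objective_pos:
  assumes "q1 > 0" and "q2 > 1" and "\<And>k. k < K \<Longrightarrow> b k > 0"
  shows "objective q1 q2 K b = ereal (\<Sum>k<K. (ln q1 - ln (b k)) / ln q2)"
proof -
  have "objective q1 q2 K b = (\<Sum>k<K. ereal ((ln q1 - ln (b k)) / ln q2))"
    unfolding objective_def using assms by (intro sum.cong) (auto simp: inv_h)
  then show ?thesis by simp
qed

lemma objective_not_pos:
  assumes "k < K" and "\<not> b k > 0"
  shows "objective q1 q2 K b = \<infinity>"
  unfolding objective_def sum_Pinfty using assms by auto

lemma objective_cong:
  assumes "\<And>k. k < K \<Longrightarrow> b k = b' k"
  shows "objective q1 q2 K b = objective q1 q2 K b'"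
  unfolding objective_def using assms by (intro sum.cong) auto

section \<open>Minimizers of the Lagrangian\<close>

text \<open>As a function of \<open>b\<^sup>2\<close>, \<open>- ln b\<close> is strictly convex, and
  this is the bound by its tangent at \<open>b\<^sup>2 = t / u\<close>.\<close>

lemma neg_ln_ge:
  fixes b t u :: real
  assumes "b > 0" and "t > 0" and "u > 0"
  shows "- ln (sqrt (t / u)) \<le> - ln b + (u * b\<^sup>2 - t) / (2 * t)"
    and "b \<noteq> sqrt (t / u) \<Longrightarrow> - ln (sqrt (t / u)) < - ln b + (u * b\<^sup>2 - t) / (2 * t)"
proof -
  define x where "x = u * b\<^sup>2 / t"
  have x: "x > 0" using assms by (simp add: x_def)
  have lnx: "ln x = 2 * ln b - 2 * ln (sqrt (t / u))"
    using assms by (simp add: x_def ln_mult ln_div ln_realpow ln_sqrt field_simps)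
  have frac: "(u * b\<^sup>2 - t) / (2 * t) = (x - 1) / 2"
    using assms by (simp add: x_def field_simps)
  show "- ln (sqrt (t / u)) \<le> - ln b + (u * b\<^sup>2 - t) / (2 * t)"
    using ln_le_minus_one[OF x] lnx frac by argo
  assume ne: "b \<noteq> sqrt (t / u)"
  have "x \<noteq> 1"
  proof
    assume "x = 1"
    then have "b\<^sup>2 = t / u" using assms by (simp add: x_def field_simps)
    then show False using ne assms by (metis less_imp_le real_sqrt_unique)
  qed
  then have "ln x < x - 1"
    using ln_le_minus_one[OF x] ln_eq_minus_one[OF x] by fastforce
  then show "- ln (sqrt (t / u)) < - ln b + (u * b\<^sup>2 - t) / (2 * t)"
    using lnx frac by argo
qed

text \<open>The budget in \<open>pen\<close> is \<open>K * t\<close>, exactly what \<open>w\<close>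
  spends, so the penalty of \<open>w\<close> vanishes and does not appear on the left. The value of
  \<open>t\<close> stays free because the dual problem needs the bound for other multipliers
  too.\<close>

lemma lagrangian_min:
  fixes b u :: "nat \<Rightarrow> real"
  assumes q: "q1 > 0" "q2 > 1" and t: "t > 0" and u: "\<And>k. k < K \<Longrightarrow> u k > 0"
    and w: "\<And>k. k < K \<Longrightarrow> w k = sqrt (t / u k)"
  defines "pen \<equiv> ((\<Sum>k<K. u k * (b k)\<^sup>2) - real K * t) / (2 * t * ln q2)"
  shows "objective q1 q2 K w \<le> objective q1 q2 K b + ereal pen"
    and "\<exists>k<K. b k \<noteq> w k \<Longrightarrow> objective q1 q2 K w < objective q1 q2 K b + ereal pen"
proof -
  have lnq: "ln q2 > 0" using q by simp
  have wpos: "w k > 0" if "k < K" for k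
    using w[OF that] u[OF that] t by simp
  note obj_w = objective_pos[OF q wpos]
  \<comment> \<open>Giving each coordinate the share \<open>t\<close> of the budget
    \<open>K * t\<close> makes the Lagrangian separate into one-variable problems.\<close>
  let ?f = "\<lambda>k. (ln q1 - ln (b k)) / ln q2 + (u k * (b k)\<^sup>2 - t) / (2 * t * ln q2)"
  have sum_f: "(\<Sum>k<K. ?f k) = (\<Sum>k<K. (ln q1 - ln (b k)) / ln q2) + pen"
    by (simp add: pen_def sum.distrib sum_subtractf flip: sum_divide_distrib)
  have f_eq: "?f k = (ln q1 + (- ln (b k) + (u k * (b k)\<^sup>2 - t) / (2 * t))) / ln q2" for k
    using lnq t by (simp add: field_simps)
  have term_le: "(ln q1 - ln (w k)) / ln q2 \<le> ?f k" if "k < K" "b k > 0" for k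
    unfolding f_eq using neg_ln_ge(1)[OF that(2) t u[OF that(1)]] w[OF that(1)] lnq
    by (intro divide_right_mono) auto
  have term_less: "(ln q1 - ln (w k)) / ln q2 < ?f k" if "k < K" "b k > 0" "b k \<noteq> w k" for k
    unfolding f_eq using neg_ln_ge(2)[OF that(2) t u[OF that(1)]] that(3) w[OF that(1)] lnq
    by (intro divide_strict_right_mono) auto
  show "objective q1 q2 K w \<le> objective q1 q2 K b + ereal pen"
  proof (cases "\<forall>k<K. b k > 0")
    case True
    then have "(\<Sum>k<K. (ln q1 - ln (w k)) / ln q2) \<le> (\<Sum>k<K. ?f k)"
      by (intro sum_mono term_le) auto
    then show ?thesis using obj_w objective_pos[OF q, of K b] True sum_f by simp
  qed (auto simp: objective_not_pos)
  assume ne: "\<exists>k<K. b k \<noteq> w k"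
  show "objective q1 q2 K w < objective q1 q2 K b + ereal pen"
  proof (cases "\<forall>k<K. b k > 0")
    case True
    then have "(\<Sum>k<K. (ln q1 - ln (w k)) / ln q2) < (\<Sum>k<K. ?f k)"
      using ne term_le term_less by (intro sum_strict_mono_ex1) auto
    then show ?thesis using obj_w objective_pos[OF q, of K b] True sum_f by simp
  \<comment> \<open>The right side is infinite here, so strictness needs the finite value of the
    left side, supplied by \<open>obj_w\<close>.\<close>
  qed (auto simp: objective_not_pos obj_w)
qed

lemma sum_mult_sqrt_squared:
  fixes u :: "nat \<Rightarrow> real"
  assumes "t > 0" and "\<And>k. k < K \<Longrightarrow> u k > 0"
  shows "(\<Sum>k<K. u k * (sqrt (t / u k))\<^sup>2) = real K * t"
proof -
  have "(\<Sum>k<K. u k * (sqrt (t / u k))\<^sup>2) = (\<Sum>k<K. t)"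
    using assms by (intro sum.cong) (auto simp: less_imp_le less_imp_neq[THEN not_sym])
  then show ?thesis by simp
qed

section \<open>The optimal pair and the primal problem\<close>

context
  fixes q1 q2 L R A :: real and K :: nat and u :: "nat \<Rightarrow> real"
  assumes q: "q1 > 0" "q2 > 1" and K: "K \<ge> 1" and LRA: "L > 0" "R > 0" "A > 0"
    and u: "\<And>k. k < K \<Longrightarrow> u k > 0"
begin

definition budget :: real where
  "budget = L * R\<^sup>2 / (4 * A)"

text \<open>The stationary point of the Lagrangian for the multiplier
  \<open>1 / (2 * t * ln q2)\<close>; each coordinate spends \<open>t\<close>.\<close>

definition level :: "real \<Rightarrow> nat \<Rightarrow> real" where
  "level t k = sqrt (t / u k)"

definition primal_opt :: "nat \<Rightarrow> real" where
  "primal_opt = level (budget / real K)"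

text \<open>The multiplier \<open>1 / (2 * t * ln q2)\<close> at \<open>t = budget / K\<close>, the
  one that belongs to \<open>primal_opt\<close>.\<close>

definition dual_opt :: real where
  "dual_opt = real K / (2 * budget * ln q2)"

lemma primal_opt_eq: "primal_opt k = sqrt (L * R\<^sup>2 / (4 * real K * A * u k))"
  by (simp add: primal_opt_def level_def budget_def mult_ac)

lemma dual_opt_eq: "dual_opt = 2 * real K * A / (L * R\<^sup>2 * ln q2)"
  by (simp add: dual_opt_def budget_def)

lemma budget_pos: "budget > 0"
  using LRA by (simp add: budget_def)

lemma dual_opt_pos: "dual_opt > 0"
  using budget_pos K q by (simp add: dual_opt_def)

lemma nonneg_level: "t > 0 \<Longrightarrow> nonneg K (level t)"
  using u by (auto simp: nonneg_def level_def less_imp_le)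

lemma sum_level: "t > 0 \<Longrightarrow> (\<Sum>k<K. u k * (level t k)\<^sup>2) = real K * t"
  unfolding level_def by (rule sum_mult_sqrt_squared) (use u in auto)

lemma sum_opt: "(\<Sum>k<K. u k * (primal_opt k)\<^sup>2) = budget"
  unfolding primal_opt_def using K budget_pos by (simp add: sum_level)

lemma feasible_opt: "feasible K u L R A primal_opt"
proof -
  have "nonneg K primal_opt"
    unfolding primal_opt_def using K budget_pos by (intro nonneg_level) simp
  then show ?thesis using sum_opt by (simp add: feasible_def budget_def)
qed

lemma objective_opt_finite: "\<bar>objective q1 q2 K primal_opt\<bar> \<noteq> \<infinity>"
proof -
  have "primal_opt k > 0" if "k < K" for k
    using u[OF that] K budget_pos by (simp add: primal_opt_def level_def)
  then show ?thesis by (simp add: objective_pos[OF q])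
qed

lemma lagrangian_budget:
  "lagrangian q1 q2 K u L R A b l =
    objective q1 q2 K b + ereal (l * ((\<Sum>k<K. u k * (b k)\<^sup>2) - budget))"
  by (simp add: lagrangian_def budget_def)

text \<open>Serves as a rewrite rule: the left side keeps the unsimplified form that
  \<open>lagrangian_min\<close> produces at \<open>t = budget / K\<close>.\<close>

lemma dual_opt_penalty:
  "(s - real K * (budget / real K)) / (2 * (budget / real K) * ln q2) = dual_opt * (s - budget)"
  using K budget_pos by (simp add: dual_opt_def field_simps)

text \<open>One half of the saddle point property: the constraint is tight at
  \<open>primal_opt\<close>, so the left side is also the Lagrangian there.\<close>

lemma objective_opt_le_lagrangian:
  shows "objective q1 q2 K primal_opt \<le> lagrangian q1 q2 K u L R A b dual_opt"
    and "\<exists>k<K. b k \<noteq> primal_opt k \<Longrightarrow> objective q1 q2 K primal_opt < lagrangian q1 q2 K u L R A b dual_opt"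
proof -
  have "budget / real K > 0" using budget_pos K by simp
  note min = lagrangian_min[where K = K and u = u and w = primal_opt and b = b, OF q this u,
      unfolded dual_opt_penalty, folded lagrangian_budget]
  show "objective q1 q2 K primal_opt \<le> lagrangian q1 q2 K u L R A b dual_opt"
    by (rule min(1)) (simp_all add: primal_opt_def level_def)
  show "objective q1 q2 K primal_opt < lagrangian q1 q2 K u L R A b dual_opt" if "\<exists>k<K. b k \<noteq> primal_opt k"
    using that by (intro min(2)) (simp_all add: primal_opt_def level_def)
qed

lemma is_arg_min_objective:
  "is_arg_min (objective q1 q2 K) (feasible K u L R A) b \<longleftrightarrow> (\<forall>k<K. b k = primal_opt k)"
proof -
  \<comment> \<open>Weak duality: a nonnegative multiplier makes the penalty of a feasible point
    nonpositive.\<close>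
  have le: "lagrangian q1 q2 K u L R A c dual_opt \<le> objective q1 q2 K c" if "feasible K u L R A c" for c
  proof -
    have "dual_opt * ((\<Sum>k<K. u k * (c k)\<^sup>2) - budget) \<le> 0"
      using that dual_opt_pos by (simp add: feasible_def budget_def mult_le_0_iff)
    then have "objective q1 q2 K c + ereal (dual_opt * ((\<Sum>k<K. u k * (c k)\<^sup>2) - budget))
        \<le> objective q1 q2 K c + 0"
      by (intro add_left_mono) (simp add: zero_ereal_def)
    then show ?thesis by (simp add: lagrangian_budget)
  qed
  show ?thesis
  proof
    assume b: "is_arg_min (objective q1 q2 K) (feasible K u L R A) b"
    show "\<forall>k<K. b k = primal_opt k"
    proof (rule ccontr)
      assume "\<not> (\<forall>k<K. b k = primal_opt k)"
      then have "objective q1 q2 K primal_opt < objective q1 q2 K b"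
        using b by (intro less_le_trans[OF objective_opt_le_lagrangian(2) le])
                   (auto simp: is_arg_min_def)
      then show False using b feasible_opt by (auto simp: is_arg_min_def)
    qed
  next
    assume b: "\<forall>k<K. b k = primal_opt k"
    then have "objective q1 q2 K b = objective q1 q2 K primal_opt"
      by (intro objective_cong) auto
    moreover have "feasible K u L R A b"
      using feasible_opt b by (simp add: feasible_def nonneg_def)
    moreover have "objective q1 q2 K primal_opt \<le> objective q1 q2 K c" if "feasible K u L R A c" for c
      using objective_opt_le_lagrangian(1) le[OF that] by (rule order_trans)
    ultimately show "is_arg_min (objective q1 q2 K) (feasible K u L R A) b"
      by (auto simp: is_arg_min_def not_less)
  qed
qed

section \<open>The dual problem\<close>

text \<open>Strong duality: the infimum is attained at \<open>primal_opt\<close>, where the penalty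
  is zero.\<close>

lemma dual_function_dual_opt: "dual_function q1 q2 K u L R A dual_opt = objective q1 q2 K primal_opt"
proof (rule antisym)
  have "dual_function q1 q2 K u L R A dual_opt \<le> lagrangian q1 q2 K u L R A primal_opt dual_opt"
    unfolding dual_function_def
    using feasible_opt by (intro INF_lower) (simp add: feasible_def)
  then show "dual_function q1 q2 K u L R A dual_opt \<le> objective q1 q2 K primal_opt"
    by (simp add: lagrangian_budget sum_opt flip: zero_ereal_def)
  show "objective q1 q2 K primal_opt \<le> dual_function q1 q2 K u L R A dual_opt"
    unfolding dual_function_def by (intro INF_greatest objective_opt_le_lagrangian)
qed

text \<open>By tightness the right side is the Lagrangian at \<open>primal_opt\<close> for every
  \<open>l\<close>, so one vector with a smaller Lagrangian suffices.\<close>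

lemma dual_function_less:
  assumes "l \<ge> 0" and "l \<noteq> dual_opt"
  shows "dual_function q1 q2 K u L R A l < objective q1 q2 K primal_opt"
proof -
  have lnq: "ln q2 > 0" using q by simp
  obtain r where r: "objective q1 q2 K primal_opt = ereal r"
    using objective_opt_finite by auto
  have dual_le: "dual_function q1 q2 K u L R A l
      \<le> objective q1 q2 K (level t) + ereal (l * (real K * t - budget))" if "t > 0" for t
  proof -
    have "dual_function q1 q2 K u L R A l \<le> lagrangian q1 q2 K u L R A (level t) l"
      unfolding dual_function_def using nonneg_level[OF that] by (intro INF_lower) simp
    then show ?thesis by (simp add: lagrangian_budget sum_level[OF that])
  qed
  \<comment> \<open>The roles are swapped: \<open>level t\<close> is now the minimizer and
    \<open>primal_opt\<close> the competitor.\<close>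
  have level_le:
    "objective q1 q2 K (level t) \<le> ereal (r + (budget - real K * t) / (2 * t * ln q2))"
    if "t > 0" for t
    using lagrangian_min(1)[where K = K and u = u and w = "level t" and b = primal_opt, OF q that u] by (simp add: level_def sum_opt r)
  show ?thesis
  proof (cases "l = 0")
    case True
    \<comment> \<open>With multiplier zero overspending is free, and spending twice the budget
      lowers the objective.\<close>
    define t where "t = 2 * budget / real K"
    have t: "t > 0" using K budget_pos by (simp add: t_def)
    have "real K * t = 2 * budget" using K by (simp add: t_def)
    then have "(budget - real K * t) / (2 * t * ln q2) < 0"
      using t lnq budget_pos by (simp add: divide_neg_pos)
    then have "objective q1 q2 K (level t) < ereal r"
      using level_le[OF t] by (auto intro: le_less_trans)
    then show ?thesis using dual_le[OF t] True r by (simp flip: zero_ereal_def)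
  next
    case False
    \<comment> \<open>Chosen so that \<open>level t\<close> minimizes the Lagrangian for
      \<open>l\<close> itself.\<close>
    define t where "t = 1 / (2 * l * ln q2)"
    have t: "t > 0" using False assms lnq by (simp add: t_def)
    have l: "1 / (2 * t * ln q2) = l" using False lnq by (simp add: t_def)
    have "t \<noteq> budget / real K"
      using l assms(2) K budget_pos by (auto simp: dual_opt_def)
    \<comment> \<open>One differing coordinate gives strictness; index 0 is available since
      \<open>K \<ge> 1\<close>.\<close>
    then have "primal_opt 0 \<noteq> level t 0"
      using u[of 0] K by (simp add: primal_opt_def level_def del: divide_divide_eq_left)
    then have "objective q1 q2 K (level t) < ereal (r + (budget - real K * t) / (2 * t * ln q2))"
      using lagrangian_min(2)[where K = K and u = u and w = "level t" and b = primal_opt, OF q t u] K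
      by (force simp: level_def sum_opt r)
    also have "(budget - real K * t) / (2 * t * ln q2) = l * (budget - real K * t)"
      using l by (metis mult.commute mult.right_neutral times_divide_eq_right)
    finally have "objective q1 q2 K (level t) < ereal (r + l * (budget - real K * t))" .
    then have "objective q1 q2 K (level t) + ereal (l * (real K * t - budget)) < ereal r"
      by (cases "objective q1 q2 K (level t)") (auto simp: algebra_simps)
    then show ?thesis using dual_le[OF t] r by simp
  qed
qed

lemma is_arg_max_dual_function:
  "is_arg_max (dual_function q1 q2 K u L R A) (\<lambda>l. l \<ge> 0) l \<longleftrightarrow> l = dual_opt"
  using dual_function_less dual_function_dual_opt dual_opt_pos
  by (auto simp: is_arg_max_def) (metis less_imp_le less_asym)+

end

theorem lemma2:
  fixes q1 q2 :: real
  assumes "q1 > 0" and "q2 > 1"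
  shows "(\<forall>b>0. inv (h q1 q2) b = (ln q1 - ln b) / ln q2) \<and>
    (\<forall>b>0. (inv (h q1 q2) has_real_derivative - (1 / (b * ln q2))) (at b)) \<and>
    (\<forall>(K::nat) (L::real) (R::real) (A::real) (u :: nat \<Rightarrow> real).
      K \<ge> 1 \<and> L > 0 \<and> R > 0 \<and> A > 0 \<and> (\<forall>k<K. u k > 0) \<longrightarrow>
        (\<forall>b. is_arg_min (objective q1 q2 K) (feasible K u L R A) b \<longleftrightarrow>
             (\<forall>k<K. b k = sqrt (L * R\<^sup>2 / (4 * real K * A * u k)))) \<and>
        (\<forall>l. is_arg_max (dual_function q1 q2 K u L R A) (\<lambda>l. l \<ge> 0) l \<longleftrightarrow>
             l = 2 * real K * A / (L * R\<^sup>2 * ln q2)))"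
proof (intro conjI allI impI; (elim conjE)?)
  show "inv (h q1 q2) b = (ln q1 - ln b) / ln q2" if "b > 0" for b
    using assms that by (rule inv_h)
  show "(inv (h q1 q2) has_real_derivative - (1 / (b * ln q2))) (at b)" if "b > 0" for b
    using assms that by (rule has_real_derivative_inv_h)
next
  fix K :: nat and L R A :: real and u b :: "nat \<Rightarrow> real"
  assume K: "K \<ge> 1" and LRA: "L > 0" "R > 0" "A > 0" and u: "\<forall>k<K. u k > 0"
  show "is_arg_min (objective q1 q2 K) (feasible K u L R A) b \<longleftrightarrow>
      (\<forall>k<K. b k = sqrt (L * R\<^sup>2 / (4 * real K * A * u k)))"
    using is_arg_min_objective[OF assms K LRA, of u b] primal_opt_eq[OF assms K LRA, of u] u by simp
next
  fix K :: nat and L R A l :: real and u :: "nat \<Rightarrow> real"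
  assume K: "K \<ge> 1" and LRA: "L > 0" "R > 0" "A > 0" and u: "\<forall>k<K. u k > 0"
  show "is_arg_max (dual_function q1 q2 K u L R A) (\<lambda>l. l \<ge> 0) l \<longleftrightarrow>
      l = 2 * real K * A / (L * R\<^sup>2 * ln q2)"
    using is_arg_max_dual_function[OF assms K LRA, of u l] dual_opt_eq[OF assms K LRA, of u] u by simp
qed

end
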